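(* Let $M$ be a $\vee e$-$\Gamma$-semigroup, let $a\in M$, $m,n\in\mathbb{N}=\{1,2,3,\dots\}$ and $\beta,\gamma\in\Gamma$. Then the $(m,n,\beta,\gamma)$-ideal element $\langle a\rangle_{(m,n,\beta,\gamma)}$ of $M$ generated by $a$ is given by $$\langle a\rangle_{(m,n,\beta,\gamma)}=a\vee a_\beta^m\beta e\gamma a_\gamma^n.$$
   Context: A $\Gamma$-semigroup consists of nonempty sets $M$ and $\Gamma$ together with a map $M\times\Gamma\times M\to M$, $(a,\gamma,b)\mapsto a\gamma b$, such that $(a\gamma b)\mu c=a\gamma(b\mu c)$ for all $a,b,c\in M$, $\gamma,\mu\in\Gamma$. A $\vee e$-$\Gamma$-semigroup is a $\Gamma$-semigroup $M$ that is also a join-semilattice (partial order $\le$ with binary supremum $\vee$) with a greatest element $e$, such that $a\gamma(b\vee c)=a\gamma b\vee a\gamma c$ and $(a\vee b)\gamma c=a\gamma c\vee b\gamma c$ for all $a,b,c\in M$, $\gamma\in\Gamma$. Powers: for $a\in M$, $\gamma\in\Gamma$, put $a_\gamma^1:=a$ and, for $m\ge 2$, $a_\gamma^m:=a\gamma a\gamma\cdots\gamma a$ ($m$ copies of $a$ and $m-1$ copies of $\gamma$). An element $t\in M$ is an $(m,n,\beta,\gamma)$-ideal element if $t_\beta^m\beta e\gamma t_\gamma^n\le t$. The $(m,n,\beta,\gamma)$-ideal element generated by $a$, denoted $\langle a\rangle_{(m,n,\beta,\gamma)}$, is the least (with respect to $\le$) $(m,n,\beta,\gamma)$-ideal element $t$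 of $M$ with $a\le t$; the claim includes that it exists. *)

theory Defs
  imports Main
begin

(* M and Gamma are the types 'a and 'g, so both are nonempty; act a g b is the product a g b. *)
locale gamma_semigroup =
  fixes act :: "'a \<Rightarrow> 'g \<Rightarrow> 'a \<Rightarrow> 'a"
  assumes act_assoc: "act (act a \<gamma> b) \<mu> c = act a \<gamma> (act b \<mu> c)"
begin

(* Powers are meant for positive exponents only. *)
fun gpow :: "'a \<Rightarrow> 'g \<Rightarrow> nat \<Rightarrow> 'a" where
  "gpow a \<gamma> 0 = undefined"
| "gpow a \<gamma> (Suc 0) = a"
| "gpow a \<gamma> (Suc (Suc k)) = act a \<gamma> (gpow a \<gamma> (Suc k))"

end

(* The greatest element e is top. *)
locale ve_gamma_semigroup = gamma_semigroup act
  for act :: "'a::{semilattice_sup, order_top} \<Rightarrow> 'g \<Rightarrow> 'a \<Rightarrow> 'a" +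
  assumes act_sup_right: "act a \<gamma> (sup b c) = sup (act a \<gamma> b) (act a \<gamma> c)"
    and act_sup_left: "act (sup a b) \<gamma> c = sup (act a \<gamma> c) (act b \<gamma> c)"
begin

definition ideal_element :: "nat \<Rightarrow> nat \<Rightarrow> 'g \<Rightarrow> 'g \<Rightarrow> 'a \<Rightarrow> bool" where
  "ideal_element m n \<beta> \<gamma> t \<longleftrightarrow>
     act (act (gpow t \<beta> m) \<beta> top) \<gamma> (gpow t \<gamma> n) \<le> t"

definition is_generated_ideal_element ::
    "nat \<Rightarrow> nat \<Rightarrow> 'g \<Rightarrow> 'g \<Rightarrow> 'a \<Rightarrow> 'a \<Rightarrow> bool" where
  "is_generated_ideal_element m n \<beta> \<gamma> a t \<longleftrightarrow>
     ideal_element m n \<beta> \<gamma> t \<and> a \<le> t \<and>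
     (\<forall>s. ideal_element m n \<beta> \<gamma> s \<and> a \<le> s \<longrightarrow> t \<le> s)"

(* Least is unspecified when there is no least such element, so existence has to be
   claimed separately, by means of is_generated_ideal_element. *)
definition generated_ideal_element :: "nat \<Rightarrow> nat \<Rightarrow> 'g \<Rightarrow> 'g \<Rightarrow> 'a \<Rightarrow> 'a" where
  "generated_ideal_element m n \<beta> \<gamma> a = (LEAST t. ideal_element m n \<beta> \<gamma> t \<and> a \<le> t)"

end

end

(* Put x = a^m e a^n and t = a \<or> x. A product of copies of a and x followed by e is absorbed:
   everything from the first x on lies below a^m e, so t^m e \<le> a^m e; symmetrically
   e t^n \<le> e a^n. Hence t^m e t^n \<le> a^m e a^n \<le> t. *)

theory Submission
  imports Defs
begin

context gamma_semigroup
begin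

lemma gpow_Suc: "k \<ge> 1 \<Longrightarrow> gpow a \<gamma> (Suc k) = act a \<gamma> (gpow a \<gamma> k)"
  by (cases k) auto

text \<open>M has no unit and \<open>gpow\<close> at 0 is unspecified, so both exponents must be
  positive. The induction therefore starts at 1, as do the later ones on exponents.\<close>

lemma gpow_add:
  assumes "i \<ge> 1" and "j \<ge> 1"
  shows "gpow a \<gamma> (i + j) = act (gpow a \<gamma> i) \<gamma> (gpow a \<gamma> j)"
  using assms(1)
proof (induction i rule: dec_induct)
  case base
  then show ?case using assms(2) by (simp add: gpow_Suc)
next
  case (step i)
  then show ?case by (simp add: gpow_Suc act_assoc)
qed

lemma gpow_Suc_right: "k \<ge> 1 \<Longrightarrow> gpow a \<gamma> (Suc k) = act (gpow a \<gamma> k) \<gamma> a"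
  using gpow_add[of k 1 a \<gamma>] by simp

end

context ve_gamma_semigroup
begin

text \<open>Distributivity gives monotonicity, because a \<le> a' means that a' is the join of a and
  a'.\<close>

lemma act_mono:
  assumes "a \<le> a'" and "b \<le> b'"
  shows "act a \<gamma> b \<le> act a' \<gamma> b'"
proof -
  have "act a \<gamma> b \<le> act a' \<gamma> b"
    using act_sup_left[of a a' \<gamma> b] assms(1) by (metis sup.absorb2 sup_ge1)
  also have "\<dots> \<le> act a' \<gamma> b'"
    using act_sup_right[of a' \<gamma> b b'] assms(2) by (metis sup.absorb2 sup_ge1)
  finally show ?thesis .
qed

lemma gpow_mono:
  assumes "k \<ge> 1" and "a \<le> b"
  shows "gpow a \<gamma> k \<le> gpow b \<gamma> k"
  using assms(1)
  by (induction k rule: dec_induct) (simp_all add: assms(2) gpow_Suc act_mono)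

text \<open>Keep the first k copies of a and bound everything after them by
  \<open>top\<close>.\<close>

lemma gpow_act_le_gpow_act_top:
  assumes "1 \<le> k" and "k \<le> m"
  shows "act (gpow a \<beta> m) \<beta> z \<le> act (gpow a \<beta> k) \<beta> top"
\<comment> \<open>If k = m, no copy of a is left over and splitting the power would produce the
  exponent 0.\<close>
proof (cases "k = m")
  case False
  then have "gpow a \<beta> m = act (gpow a \<beta> k) \<beta> (gpow a \<beta> (m - k))"
    using assms gpow_add[of k "m - k" a \<beta>] by simp
  then show ?thesis by (simp add: act_assoc act_mono)
qed (simp add: act_mono)

lemma act_gpow_le_top_act_gpow:
  assumes "1 \<le> k" and "k \<le> n"
  shows "act z \<gamma> (gpow a \<gamma> n) \<le> act top \<gamma> (gpow a \<gamma> k)"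
proof (cases "k = n")
  case False
  then have "gpow a \<gamma> n = act (gpow a \<gamma> (n - k)) \<gamma> (gpow a \<gamma> k)"
    using assms gpow_add[of "n - k" k a \<gamma>] by simp
  then show ?thesis by (simp add: act_assoc[symmetric] act_mono)
qed (simp add: act_mono)

text \<open>Induction peels off the leftmost factor. Its summand a lengthens the power by one, and
  its other summand starts with m copies of a, enough to be absorbed as long as k \<le> m. Leaving z
  free lets the rest of x be ignored.\<close>

lemma gpow_sup_act_top_le:
  assumes "1 \<le> k" and "k \<le> m"
  shows "act (gpow (sup a (act (gpow a \<beta> m) \<beta> z)) \<beta> k) \<beta> top
           \<le> act (gpow a \<beta> k) \<beta> top"
  using assms
proof (induction k rule: dec_induct)
  case base
  \<comment> \<open>After distributing, the second summand ends in \<open>act z \<beta> top\<close>,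
    which takes the place of z in the absorption.\<close>
  then show ?case
    using gpow_act_le_gpow_act_top[of 1 m a \<beta> "act z \<beta> top"]
    by (simp add: act_sup_left act_assoc)
next
  case (step k)
  let ?t = "sup a (act (gpow a \<beta> m) \<beta> z)"
  have "act (gpow ?t \<beta> (Suc k)) \<beta> top = act ?t \<beta> (act (gpow ?t \<beta> k) \<beta> top)"
    using step.hyps by (simp add: gpow_Suc act_assoc)
  also have "\<dots> \<le> act ?t \<beta> (act (gpow a \<beta> k) \<beta> top)"
    using step by (intro act_mono[OF order_refl]) simp
  also have "\<dots> = sup (act (gpow a \<beta> (Suc k)) \<beta> top)
                       (act (gpow a \<beta> m) \<beta> (act z \<beta> (act (gpow a \<beta> k) \<beta> top)))"
    using step.hyps by (simp add: gpow_Suc act_sup_left act_assoc)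
  also have "\<dots> \<le> act (gpow a \<beta> (Suc k)) \<beta> top"
    using step.prems gpow_act_le_gpow_act_top[of "Suc k" m] by simp
  finally show ?case .
qed

text \<open>The mirror image: the rightmost factor is peeled off, hence
  \<open>gpow_Suc_right\<close>, and absorption acts on the final n copies of a.\<close>

lemma top_act_gpow_sup_le:
  assumes "1 \<le> k" and "k \<le> n"
  shows "act top \<gamma> (gpow (sup a (act z \<gamma> (gpow a \<gamma> n))) \<gamma> k)
           \<le> act top \<gamma> (gpow a \<gamma> k)"
  using assms
proof (induction k rule: dec_induct)
  case base
  then show ?case
    using act_gpow_le_top_act_gpow[of 1 n "act top \<gamma> z" \<gamma> a]
    by (simp add: act_sup_right act_assoc)
next
  case (step k)
  let ?t = "sup a (act z \<gamma> (gpow a \<gamma> n))"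
  have "act top \<gamma> (gpow ?t \<gamma> (Suc k)) = act (act top \<gamma> (gpow ?t \<gamma> k)) \<gamma> ?t"
    using step.hyps by (simp add: gpow_Suc_right act_assoc)
  also have "\<dots> \<le> act (act top \<gamma> (gpow a \<gamma> k)) \<gamma> ?t"
    using step by (intro act_mono[OF _ order_refl]) simp
  also have "\<dots> = sup (act top \<gamma> (gpow a \<gamma> (Suc k)))
                       (act (act (act top \<gamma> (gpow a \<gamma> k)) \<gamma> z) \<gamma> (gpow a \<gamma> n))"
    using step.hyps by (simp add: gpow_Suc_right act_sup_right act_assoc)
  also have "\<dots> \<le> act top \<gamma> (gpow a \<gamma> (Suc k))"
    using step.prems act_gpow_le_top_act_gpow[of "Suc k" n] by simp
  finally show ?case .
qed

lemma ideal_element_sup: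
  assumes "m \<ge> 1" and "n \<ge> 1"
  shows "ideal_element m n \<beta> \<gamma> (sup a (act (act (gpow a \<beta> m) \<beta> top) \<gamma> (gpow a \<gamma> n)))"
    (is "ideal_element m n \<beta> \<gamma> ?t")
proof -
  have "act (act (gpow ?t \<beta> m) \<beta> top) \<gamma> (gpow ?t \<gamma> n)
          \<le> act (act (gpow a \<beta> m) \<beta> top) \<gamma> (gpow ?t \<gamma> n)"
    \<comment> \<open>Here x is bracketed as a^m \<beta> (e \<gamma> a^n), so z is e \<gamma>
      a^n.\<close>
    using gpow_sup_act_top_le[of m m a \<beta> "act top \<gamma> (gpow a \<gamma> n)"] assms(1)
    by - (rule act_mono[OF _ order_refl], simp add: act_assoc)
  also have "\<dots> = act (gpow a \<beta> m) \<beta> (act top \<gamma> (gpow ?t \<gamma> n))"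
    by (rule act_assoc)
  \<comment> \<open>Here the original bracketing of x is used, with z equal to a^m \<beta>
    e.\<close>
  also have "\<dots> \<le> act (gpow a \<beta> m) \<beta> (act top \<gamma> (gpow a \<gamma> n))"
    using assms(2) by (simp add: act_mono[OF order_refl] top_act_gpow_sup_le)
  also have "\<dots> \<le> ?t"
    by (simp add: act_assoc)
  finally show ?thesis
    unfolding ideal_element_def .
qed

text \<open>For minimality, a \<le> s and monotonicity of powers put x below s^m e s^n, which lies
  below s because s is an ideal element.\<close>

lemma is_generated_ideal_element_sup:
  assumes "m \<ge> 1" and "n \<ge> 1"
  shows "is_generated_ideal_element m n \<beta> \<gamma> a
           (sup a (act (act (gpow a \<beta> m) \<beta> top) \<gamma> (gpow a \<gamma> n)))"
  unfolding is_generated_ideal_element_def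
proof (intro conjI allI impI)
  fix s
  assume s: "ideal_element m n \<beta> \<gamma> s \<and> a \<le> s"
  have "act (act (gpow a \<beta> m) \<beta> top) \<gamma> (gpow a \<gamma> n)
          \<le> act (act (gpow s \<beta> m) \<beta> top) \<gamma> (gpow s \<gamma> n)"
    using s assms by (intro act_mono gpow_mono) simp_all
  also have "\<dots> \<le> s"
    using s by (simp add: ideal_element_def)
  finally show "sup a (act (act (gpow a \<beta> m) \<beta> top) \<gamma> (gpow a \<gamma> n)) \<le> s"
    using s by simp
qed (use ideal_element_sup[OF assms] in simp_all)

lemma generated_ideal_element_eqI:
  "is_generated_ideal_element m n \<beta> \<gamma> a t \<Longrightarrow> generated_ideal_element m n \<beta> \<gamma> a = t"
  unfolding is_generated_ideal_element_def generated_ideal_element_def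
  by (intro Least_equality) auto

end

theorem lemma6:
  fixes act :: "'a::{semilattice_sup, order_top} \<Rightarrow> 'g \<Rightarrow> 'a \<Rightarrow> 'a"
    and a :: 'a and m n :: nat and \<beta> \<gamma> :: 'g
  assumes "ve_gamma_semigroup act"
    and "m \<ge> 1" and "n \<ge> 1"
  shows "ve_gamma_semigroup.is_generated_ideal_element act m n \<beta> \<gamma> a
           (ve_gamma_semigroup.generated_ideal_element act m n \<beta> \<gamma> a)
       \<and> ve_gamma_semigroup.generated_ideal_element act m n \<beta> \<gamma> a
         = sup a (act (act (gamma_semigroup.gpow act a \<beta> m) \<beta> top) \<gamma>
                      (gamma_semigroup.gpow act a \<gamma> n))"
proof -
  interpret ve_gamma_semigroup act by (rule assms(1))
  note gen = is_generated_ideal_element_sup[OF assms(2,3), of \<beta> \<gamma> a]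
  \<comment> \<open>Rewriting \<open>generated_ideal_element\<close> to the explicit join turns the
    existence claim into \<open>gen\<close>.\<close>
  show ?thesis
    using gen generated_ideal_element_eqI[OF gen] by simp
qed

end
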